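(* Let $M$ be an irredundant finite structure of order $n$ whose vocabulary has maximum relation arity $k$. Then $$D_1(M) < \left(1-\frac{1}{2k}\right)n + k^2-k+1,$$ where $D_1(M)$ is the minimum quantifier rank of a first-order formula with alternation number at most $1$ that defines $M$.
   Context: A vocabulary $L$ is a finite list of relation symbols with positive integer arities; its maximum relation arity is the largest arity. An $L$-structure $M$ consists of a finite universe $V(M)$ and, for each $l$-ary symbol $R$, a relation $R^M: V(M)^l\to\{0,1\}$; the order of $M$ is $|V(M)|$. For $a,b\in V(M)$ write $a\sim b$ if the transposition of $a$ and $b$ (the permutation of $V(M)$ swapping $a,b$ and fixing everything else) is an automorphism of $M$. $M$ is irredundant if no transposition of two distinct elements is an automorphism of $M$. First-order formulas are over $L\cup\{=\}$ with connectives $\neg,\wedge,\vee$. For a formula $\Phi$, define $\mathrm{nest}(\Phi)$: $\{\text{empty word}\}$ for atomic $\Phi$; swap $\exists,\forall$ in all words for $\neg\Phi$; union for $\wedge,\vee$; prefix $\exists$ (resp. $\forall$) for $\exists x\Phi$ (resp. $\forall x\Phi$). Quantifier rank = maximum word length in $\mathrm{nest}(\Phi)$; alternation number = maximum number of occurrences of $\exists\forall$ or $\forall\exists$ as consecutive letters in a word of $\mathrm{nest}(\Phi)$. A closed formula $\Phi$ defines $M$ if $\Phi$ is true on $M$ and false on every $L$-structure (of any order) not isomorphic to $M$.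
   Formalization: The formal theorem assumes k ≥ 2 or n ≥ 3: for k = 1 and n ≤ 2 the printed bound fails for every structure (e.g. n = 1: it would give D_1 ≤ 1, but rank-1 sentences over unary relations cannot detect a duplicated element). The vocabulary is assumed nonempty so that k exists. *)

theory Defs
  imports Complex_Main "HOL-Combinatorics.Transposition"
begin

text \<open>A vocabulary is the list of the arities of its relation symbols; the symbols themselves are
  the positions in the list.\<close>

type_synonym vocab = "nat list"

definition vocabulary :: "vocab \<Rightarrow> bool" where
  "vocabulary L \<longleftrightarrow> (\<forall>l\<in>set L. 0 < l)"

definition max_arity :: "vocab \<Rightarrow> nat" where
  "max_arity L = Max (set L)"

record 'a struct =
  univ :: "'a set"
  rel :: "nat \<Rightarrow> 'a list \<Rightarrow> bool"

definition tuples :: "'a struct \<Rightarrow> nat \<Rightarrow> 'a list set" where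
  "tuples M l = {as. length as = l \<and> set as \<subseteq> univ M}"

definition is_struct :: "vocab \<Rightarrow> 'a struct \<Rightarrow> bool" where
  "is_struct L M \<longleftrightarrow> finite (univ M) \<and> (\<forall>R<length L. \<forall>as. rel M R as \<longrightarrow> as \<in> tuples M (L ! R))"

definition iso :: "vocab \<Rightarrow> ('a \<Rightarrow> 'b) \<Rightarrow> 'a struct \<Rightarrow> 'b struct \<Rightarrow> bool" where
  "iso L f M N \<longleftrightarrow> bij_betw f (univ M) (univ N) \<and>
     (\<forall>R<length L. \<forall>as\<in>tuples M (L ! R). rel M R as \<longleftrightarrow> rel N R (map f as))"

definition isomorphic :: "vocab \<Rightarrow> 'a struct \<Rightarrow> 'b struct \<Rightarrow> bool" where
  "isomorphic L M N \<longleftrightarrow> (\<exists>f. iso L f M N)"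

definition automorphism :: "vocab \<Rightarrow> ('a \<Rightarrow> 'a) \<Rightarrow> 'a struct \<Rightarrow> bool" where
  "automorphism L f M \<longleftrightarrow> iso L f M M"

definition irredundant :: "vocab \<Rightarrow> 'a struct \<Rightarrow> bool" where
  "irredundant L M \<longleftrightarrow>
     (\<forall>a\<in>univ M. \<forall>b\<in>univ M. a \<noteq> b \<longrightarrow> \<not> automorphism L (transpose a b) M)"

datatype fm =
    Eq nat nat
  | Rel nat "nat list"
  | Neg fm
  | Conj fm fm
  | Disj fm fm
  | Ex nat fm
  | All nat fm

fun wf_fm :: "vocab \<Rightarrow> fm \<Rightarrow> bool" where
  "wf_fm L (Eq x y) \<longleftrightarrow> True"
| "wf_fm L (Rel R xs) \<longleftrightarrow> R < length L \<and> length xs = L ! R"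
| "wf_fm L (Neg \<phi>) \<longleftrightarrow> wf_fm L \<phi>"
| "wf_fm L (Conj \<phi> \<psi>) \<longleftrightarrow> wf_fm L \<phi> \<and> wf_fm L \<psi>"
| "wf_fm L (Disj \<phi> \<psi>) \<longleftrightarrow> wf_fm L \<phi> \<and> wf_fm L \<psi>"
| "wf_fm L (Ex x \<phi>) \<longleftrightarrow> wf_fm L \<phi>"
| "wf_fm L (All x \<phi>) \<longleftrightarrow> wf_fm L \<phi>"

fun free_vars :: "fm \<Rightarrow> nat set" where
  "free_vars (Eq x y) = {x, y}"
| "free_vars (Rel R xs) = set xs"
| "free_vars (Neg \<phi>) = free_vars \<phi>"
| "free_vars (Conj \<phi> \<psi>) = free_vars \<phi> \<union> free_vars \<psi>"
| "free_vars (Disj \<phi> \<psi>) = free_vars \<phi> \<union> free_vars \<psi>"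
| "free_vars (Ex x \<phi>) = free_vars \<phi> - {x}"
| "free_vars (All x \<phi>) = free_vars \<phi> - {x}"

fun sat :: "'a struct \<Rightarrow> (nat \<Rightarrow> 'a) \<Rightarrow> fm \<Rightarrow> bool" where
  "sat M e (Eq x y) \<longleftrightarrow> e x = e y"
| "sat M e (Rel R xs) \<longleftrightarrow> rel M R (map e xs)"
| "sat M e (Neg \<phi>) \<longleftrightarrow> \<not> sat M e \<phi>"
| "sat M e (Conj \<phi> \<psi>) \<longleftrightarrow> sat M e \<phi> \<and> sat M e \<psi>"
| "sat M e (Disj \<phi> \<psi>) \<longleftrightarrow> sat M e \<phi> \<or> sat M e \<psi>"
| "sat M e (Ex x \<phi>) \<longleftrightarrow> (\<exists>a\<in>univ M. sat M (e(x := a)) \<phi>)"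
| "sat M e (All x \<phi>) \<longleftrightarrow> (\<forall>a\<in>univ M. sat M (e(x := a)) \<phi>)"

definition closed_fm :: "vocab \<Rightarrow> fm \<Rightarrow> bool" where
  "closed_fm L \<phi> \<longleftrightarrow> wf_fm L \<phi> \<and> free_vars \<phi> = {}"

text \<open>Only used for closed formulas, whose truth does not depend on the assignment. Quantifying
  over all assignments into the type, not only into the universe, keeps this correct for an empty
  universe.\<close>

definition true_on :: "'a struct \<Rightarrow> fm \<Rightarrow> bool" where
  "true_on M \<phi> \<longleftrightarrow> (\<forall>e. sat M e \<phi>)"

datatype quant = QEx | QAll

fun dual :: "quant \<Rightarrow> quant" where
  "dual QEx = QAll"
| "dual QAll = QEx"

fun nest :: "fm \<Rightarrow> quant list set" where
  "nest (Eq x y) = {[]}"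
| "nest (Rel R xs) = {[]}"
| "nest (Neg \<phi>) = map dual ` nest \<phi>"
| "nest (Conj \<phi> \<psi>) = nest \<phi> \<union> nest \<psi>"
| "nest (Disj \<phi> \<psi>) = nest \<phi> \<union> nest \<psi>"
| "nest (Ex x \<phi>) = (#) QEx ` nest \<phi>"
| "nest (All x \<phi>) = (#) QAll ` nest \<phi>"

definition quantifier_rank :: "fm \<Rightarrow> nat" where
  "quantifier_rank \<phi> = Max (length ` nest \<phi>)"

definition alternations :: "quant list \<Rightarrow> nat" where
  "alternations w = card {i. Suc i < length w \<and> w ! i \<noteq> w ! Suc i}"

definition alternation_number :: "fm \<Rightarrow> nat" where
  "alternation_number \<phi> = Max (alternations ` nest \<phi>)"

text \<open>The structures to be told apart from \<open>M\<close> live on subsets of \<open>nat\<close>. As all structures are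
  finite, every structure on any type is isomorphic to one of these, so nothing is lost.\<close>

definition defines_struct :: "vocab \<Rightarrow> fm \<Rightarrow> 'a struct \<Rightarrow> bool" where
  "defines_struct L \<phi> M \<longleftrightarrow> closed_fm L \<phi> \<and> true_on M \<phi> \<and>
     (\<forall>N :: nat struct. is_struct L N \<longrightarrow> \<not> isomorphic L M N \<longrightarrow> \<not> true_on N \<phi>)"

definition D1 :: "vocab \<Rightarrow> 'a struct \<Rightarrow> nat" where
  "D1 L M = (LEAST r. \<exists>\<phi>. defines_struct L \<phi> M \<and> alternation_number \<phi> \<le> 1 \<and> quantifier_rank \<phi> = r)"

end

theory Submission
  imports Defs
begin

text \<open>
  Call two elements outside a set \<open>W\<close> equivalent if they have the same atomic type over \<open>W\<close>. Build up
  \<open>W\<close> from the empty set by alternating two moves: (a) as long as adding fewer than \<open>k\<close> elements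
  increases the number of classes, add them and put them into \<open>X\<close>; (b) absorb all classes of size
  at most \<open>k\<close> as a new layer, putting all but one element of each of them into \<open>X\<close>. Each element kept
  out of \<open>X\<close> is then determined by its type over \<open>X\<close> and the lower layers. A set of fewer than \<open>k\<close>
  elements that separates two elements still equivalent must meet every layer, as otherwise it
  would have been a move (a) before the layer that it misses; hence after \<open>k - 1\<close> layers no such set
  is left, and by irredundancy all remaining classes have at most \<open>k\<close> elements. So \<open>k\<close> layers
  exhaust the structure, and counting classes shows that \<open>X\<close> has fewer than \<open>(1 - 1/(2k)) n\<close> elements.

  The defining formula names the elements of \<open>X\<close> by existential quantifiers and then says that
  neither of the one-sided Ehrenfeucht games with \<open>k^2 - k + 1\<close> rounds (two rounds if \<open>k = 1\<close>), where
  Spoiler stays in one structure throughout, is won by Spoiler. Such a game needs \<open>k - 1\<close> rounds per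
  layer above the first to pin down an element, which leaves \<open>k\<close> rounds to compare a tuple.
\<close>

section \<open>One-sided Ehrenfeucht games\<close>

text \<open>Duplicator survives \<open>j\<close> more rounds from the position \<open>P\<close> if Spoiler always plays in \<open>M\<close>.\<close>

fun sim :: "vocab \<Rightarrow> 'a struct \<Rightarrow> 'b struct \<Rightarrow> nat \<Rightarrow> ('a \<times> 'b) set \<Rightarrow> bool" where
  "sim L M N 0 P \<longleftrightarrow> (\<forall>p\<in>P. \<forall>q\<in>P. fst p = fst q \<longleftrightarrow> snd p = snd q) \<and>
     (\<forall>R<length L. \<forall>ps. length ps = L ! R \<longrightarrow> set ps \<subseteq> P \<longrightarrow>
        (rel M R (map fst ps) \<longleftrightarrow> rel N R (map snd ps)))"
| "sim L M N (Suc j) P \<longleftrightarrow> (\<forall>c\<in>univ M. \<exists>d\<in>univ N. sim L M N j (insert (c, d) P))"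

lemma sim_0_eq: "sim L M N 0 P \<Longrightarrow> (a, b) \<in> P \<Longrightarrow> (c, d) \<in> P \<Longrightarrow> a = c \<longleftrightarrow> b = d"
  by force

lemma sim_0_rel:
  "sim L M N 0 P \<Longrightarrow> R < length L \<Longrightarrow> length ps = L ! R \<Longrightarrow> set ps \<subseteq> P \<Longrightarrow>
   rel M R (map fst ps) \<longleftrightarrow> rel N R (map snd ps)"
  by simp

lemma sim_0I:
  assumes "\<And>a b c d. (a, b) \<in> P \<Longrightarrow> (c, d) \<in> P \<Longrightarrow> a = c \<longleftrightarrow> b = d"
    and "\<And>R ps. R < length L \<Longrightarrow> length ps = L ! R \<Longrightarrow> set ps \<subseteq> P \<Longrightarrow>
      rel M R (map fst ps) \<longleftrightarrow> rel N R (map snd ps)"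
  shows "sim L M N 0 P"
  using assms by auto

declare sim.simps(1) [simp del]

lemma sim_mono: "sim L M N j P \<Longrightarrow> Q \<subseteq> P \<Longrightarrow> sim L M N j Q"
proof (induction j arbitrary: P Q)
  case 0
  show ?case
    using sim_0_eq[OF 0(1)] sim_0_rel[OF 0(1)] 0(2)
    by (intro sim_0I) (blast, meson order_trans)
next
  case (Suc j)
  then show ?case by (metis insert_mono sim.simps(2))
qed

text \<open>Spoiler plays any element and the extra pair is forgotten. An empty universe has to be
  excluded, since Duplicator vacuously survives every game of at least one round on it.\<close>

lemma sim_Suc_imp: "univ M \<noteq> {} \<Longrightarrow> sim L M N (Suc j) P \<Longrightarrow> sim L M N j P"
  by (metis all_not_in_conv sim.simps(2) sim_mono subset_insertI)

lemma sim_le: "univ M \<noteq> {} \<Longrightarrow> sim L M N j P \<Longrightarrow> i \<le> j \<Longrightarrow> sim L M N i P"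
  by (induction j) (metis le_zero_eq, metis le_Suc_eq sim_Suc_imp)

text \<open>Duplicator plays both games at once: the answer in \<open>N\<close> is passed on as
  Spoiler's move in the second game.\<close>

lemma sim_trans: "sim L M N j P \<Longrightarrow> sim L N O' j Q \<Longrightarrow> sim L M O' j (P O Q)"
proof (induction j arbitrary: P Q)
  case 0
  have "rel M R (map fst ps) \<longleftrightarrow> rel O' R (map snd ps)"
    if R: "R < length L" and ps: "length ps = L ! R" "set ps \<subseteq> P O Q" for R ps
  proof -
    have "\<forall>p\<in>set ps. \<exists>b. (fst p, b) \<in> P \<and> (b, snd p) \<in> Q" using ps(2) by fastforce
    then obtain g where g: "\<And>p. p \<in> set ps \<Longrightarrow> (fst p, g p) \<in> P \<and> (g p, snd p) \<in> Q" by metis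
    have "rel M R (map fst (map (\<lambda>p. (fst p, g p)) ps)) \<longleftrightarrow> rel N R (map snd (map (\<lambda>p. (fst p, g p)) ps))"
      using g by (intro sim_0_rel[OF 0(1) R]) (auto simp: ps(1))
    moreover have "rel N R (map fst (map (\<lambda>p. (g p, snd p)) ps)) \<longleftrightarrow> rel O' R (map snd (map (\<lambda>p. (g p, snd p)) ps))"
      using g by (intro sim_0_rel[OF 0(2) R]) (auto simp: ps(1))
    ultimately show ?thesis by (simp add: comp_def)
  qed
  moreover have "a = c \<longleftrightarrow> b = d" if ab: "(a, b) \<in> P O Q" "(c, d) \<in> P O Q" for a b c d
  proof -
    obtain x y where "(a, x) \<in> P" "(x, b) \<in> Q" "(c, y) \<in> P" "(y, d) \<in> Q" using ab by blast
    then show ?thesis using sim_0_eq[OF 0(1)] sim_0_eq[OF 0(2)] by metis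
  qed
  ultimately show ?case by (intro sim_0I)
next
  case (Suc j)
  have "\<exists>e\<in>univ O'. sim L M O' j (insert (c, e) (P O Q))" if c: "c \<in> univ M" for c
  proof -
    obtain d where d: "d \<in> univ N" "sim L M N j (insert (c, d) P)" using Suc.prems(1) c by auto
    obtain e where e: "e \<in> univ O'" "sim L N O' j (insert (d, e) Q)" using Suc.prems(2) d(1) by auto
    have "sim L M O' j (insert (c, d) P O insert (d, e) Q)" using Suc.IH d(2) e(2) .
    then have "sim L M O' j (insert (c, e) (P O Q))" by (rule sim_mono) blast
    then show ?thesis using e(1) by blast
  qed
  then show ?case by simp
qed

lemma sim_refl: "P \<subseteq> Id \<Longrightarrow> sim L M M j P"
proof (induction j arbitrary: P)
  case 0
  have "map fst ps = map snd ps" if "set ps \<subseteq> P" for ps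
    using 0 that by (auto simp: subset_iff)
  moreover have "a = b" if "(a, b) \<in> P" for a b using 0 that by blast
  ultimately show ?case by (intro sim_0I) metis+
next
  case (Suc j)
  have "sim L M M j (insert (c, c) P)" for c using Suc by simp
  then show ?case by auto
qed

lemma sim_moves:
  "sim L M N (length cs + j) P \<Longrightarrow> set cs \<subseteq> univ M \<Longrightarrow>
   \<exists>ds. length ds = length cs \<and> set ds \<subseteq> univ N \<and> sim L M N j (set (zip cs ds) \<union> P)"
proof (induction cs arbitrary: P)
  case (Cons c cs)
  then obtain d where d: "d \<in> univ N" "sim L M N (length cs + j) (insert (c, d) P)" by auto
  with Cons obtain ds where ds: "length ds = length cs" "set ds \<subseteq> univ N"
    "sim L M N j (set (zip cs ds) \<union> insert (c, d) P)" by fastforce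
  then show ?case using d by (intro exI[of _ "d # ds"]) simp
qed simp

text \<open>Enumerating \<open>S\<close> without repetition costs \<open>card S\<close> rounds and
  makes the answers a function on \<open>S\<close>.\<close>

lemma sim_moves_fun:
  assumes "sim L M N j P" "finite S" "S \<subseteq> univ M" "card S + i \<le> j" "univ M \<noteq> {}"
  shows "\<exists>h. h ` S \<subseteq> univ N \<and> sim L M N i ((\<lambda>s. (s, h s)) ` S \<union> P)"
proof -
  obtain cs where cs: "set cs = S" "distinct cs" using assms(2) finite_distinct_list by blast
  then have "sim L M N (length cs + i) P" using sim_le[OF assms(5,1)] assms(4) distinct_card by fastforce
  then obtain ds where ds: "length ds = length cs" "set ds \<subseteq> univ N"
    "sim L M N i (set (zip cs ds) \<union> P)" using sim_moves cs(1) assms(3) by metis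
  define h where "h c = the (map_of (zip cs ds) c)" for c
  have h: "(s, h s) \<in> set (zip cs ds)" if "s \<in> S" for s
  proof -
    have "map_of (zip cs ds) s \<noteq> None" using that cs(1) ds(1) by (simp add: map_of_zip_is_None)
    then show ?thesis unfolding h_def by (auto dest: map_of_SomeD)
  qed
  have "h ` S \<subseteq> univ N" using h ds(2) by (auto dest: set_zip_rightD)
  moreover have "sim L M N i ((\<lambda>s. (s, h s)) ` S \<union> P)"
    by (rule sim_mono[OF ds(3)]) (use h in auto)
  ultimately show ?thesis by blast
qed

section \<open>Defining formulas\<close>

text \<open>The value on the empty list is never used: it would not be closed.\<close>

fun conjs :: "fm list \<Rightarrow> fm" where
  "conjs [] = Eq 0 0"
| "conjs [\<phi>] = \<phi>"
| "conjs (\<phi> # \<psi> # \<phi>s) = Conj \<phi> (conjs (\<psi> # \<phi>s))"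

fun disjs :: "fm list \<Rightarrow> fm" where
  "disjs [] = Neg (Eq 0 0)"
| "disjs [\<phi>] = \<phi>"
| "disjs (\<phi> # \<psi> # \<phi>s) = Disj \<phi> (disjs (\<psi> # \<phi>s))"

lemma conjs_simps:
  assumes "\<phi>s \<noteq> []"
  shows "sat M e (conjs \<phi>s) \<longleftrightarrow> (\<forall>\<phi>\<in>set \<phi>s. sat M e \<phi>)"
    and "wf_fm L (conjs \<phi>s) \<longleftrightarrow> (\<forall>\<phi>\<in>set \<phi>s. wf_fm L \<phi>)"
    and "free_vars (conjs \<phi>s) = (\<Union>\<phi>\<in>set \<phi>s. free_vars \<phi>)"
    and "nest (conjs \<phi>s) = (\<Union>\<phi>\<in>set \<phi>s. nest \<phi>)"
  using assms by (induction \<phi>s rule: conjs.induct) auto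

lemma disjs_simps:
  assumes "\<phi>s \<noteq> []"
  shows "sat M e (disjs \<phi>s) \<longleftrightarrow> (\<exists>\<phi>\<in>set \<phi>s. sat M e \<phi>)"
    and "wf_fm L (disjs \<phi>s) \<longleftrightarrow> (\<forall>\<phi>\<in>set \<phi>s. wf_fm L \<phi>)"
    and "free_vars (disjs \<phi>s) = (\<Union>\<phi>\<in>set \<phi>s. free_vars \<phi>)"
    and "nest (disjs \<phi>s) = (\<Union>\<phi>\<in>set \<phi>s. nest \<phi>)"
  using assms by (induction \<phi>s rule: disjs.induct) auto

section \<open>Atomic diagrams as formulas\<close>

definition lit :: "bool \<Rightarrow> fm \<Rightarrow> fm" where
  "lit b \<phi> = (if b then \<phi> else Neg \<phi>)"

lemma lit_simps:
  "sat M e (lit b \<phi>) \<longleftrightarrow> (b \<longleftrightarrow> sat M e \<phi>)"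
  "wf_fm L (lit b \<phi>) \<longleftrightarrow> wf_fm L \<phi>"
  "free_vars (lit b \<phi>) = free_vars \<phi>"
  "nest \<phi> = {[]} \<Longrightarrow> nest (lit b \<phi>) = {[]}"
  by (auto simp: lit_def)

text \<open>The atomic diagram of \<open>a 0\<close>, ..., \<open>a (m - 1)\<close>, with variable
  \<open>i\<close> naming \<open>a i\<close>.\<close>

definition diagram :: "vocab \<Rightarrow> 'a struct \<Rightarrow> nat \<Rightarrow> (nat \<Rightarrow> 'a) \<Rightarrow> fm list" where
  "diagram L M m a =
     [lit (a i = a j) (Eq i j). i \<leftarrow> [0..<m], j \<leftarrow> [0..<m]] @
     [lit (rel M R (map a xs)) (Rel R xs). R \<leftarrow> [0..<length L], xs \<leftarrow> List.n_lists (L ! R) [0..<m]]"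

lemma set_diagram:
  "set (diagram L M m a) =
     {lit (a i = a j) (Eq i j) | i j. i < m \<and> j < m} \<union>
     {lit (rel M R (map a xs)) (Rel R xs) | R xs. R < length L \<and> length xs = L ! R \<and> set xs \<subseteq> {..<m}}"
  unfolding diagram_def by (auto simp: set_n_lists subset_iff) blast+

lemma diagram_nonempty: "0 < m \<Longrightarrow> diagram L M m a \<noteq> []"
  by (auto simp: diagram_def intro!: exI[of _ 0])

lemma sat_diagram:
  assumes "0 < m"
  shows "sat N e (conjs (diagram L M m a)) \<longleftrightarrow> sim L M N 0 ((\<lambda>i. (a i, e i)) ` {..<m})"
proof -
  let ?f = "\<lambda>i. (a i, e i)"
  \<comment> \<open>Lists of pairs from the position are images of lists of indices, which turns the
    condition of the game into one on variables.\<close>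
  have tup: "(\<forall>ps. length ps = l \<longrightarrow> set ps \<subseteq> ?f ` {..<m} \<longrightarrow> (rel M R (map fst ps) \<longleftrightarrow> rel N R (map snd ps))) \<longleftrightarrow>
    (\<forall>xs. length xs = l \<and> set xs \<subseteq> {..<m} \<longrightarrow> (rel M R (map a xs) \<longleftrightarrow> rel N R (map e xs)))" (is "?A \<longleftrightarrow> ?B") for R l
  proof
    assume A: ?A
    show ?B
    proof (intro allI impI)
      fix xs assume xs: "length xs = l \<and> set xs \<subseteq> {..<m}"
      then show "rel M R (map a xs) \<longleftrightarrow> rel N R (map e xs)"
        using A[rule_format, of "map ?f xs"] by (auto simp: comp_def)
    qed
  next
    assume B: ?B
    show ?A
    proof (intro allI impI)
      fix ps assume ps: "length ps = l" "set ps \<subseteq> ?f ` {..<m}"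
      then have "ps \<in> lists (?f ` {..<m})" by auto
      then obtain xs where "ps = map ?f xs" "set xs \<subseteq> {..<m}"
        by (auto simp: lists_image)
      then show "rel M R (map fst ps) \<longleftrightarrow> rel N R (map snd ps)"
        using B ps(1) by (auto simp: comp_def)
    qed
  qed
  have "sat N e (conjs (diagram L M m a)) \<longleftrightarrow>
      (\<forall>i<m. \<forall>j<m. (a i = a j) = (e i = e j)) \<and>
      (\<forall>R<length L. \<forall>xs. length xs = L ! R \<and> set xs \<subseteq> {..<m} \<longrightarrow> (rel M R (map a xs) \<longleftrightarrow> rel N R (map e xs)))"
    unfolding conjs_simps(1)[OF diagram_nonempty[OF assms]] set_diagram ball_Un
    by (intro arg_cong2[where f = "(\<and>)"]) (force simp: lit_simps)+
  also have "\<dots> \<longleftrightarrow> sim L M N 0 (?f ` {..<m})"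
    unfolding sim.simps tup by auto
  finally show ?thesis .
qed

section \<open>Formulas for the one-sided games\<close>

definition enum_set :: "'a set \<Rightarrow> 'a list" where
  "enum_set A = (SOME xs. set xs = A)"

lemma set_enum_set: "finite A \<Longrightarrow> set (enum_set A) = A"
  unfolding enum_set_def by (rule someI_ex) (rule finite_list)

lemma enum_set_nonempty: "finite A \<Longrightarrow> A \<noteq> {} \<Longrightarrow> enum_set A \<noteq> []"
  using set_enum_set by fastforce

text \<open>One half of a Hintikka formula. Spoiler's moves in \<open>M\<close> become a conjunction
  over its elements and Duplicator's answers existential quantifiers. The number \<open>m\<close> of
  variables in use serves as the next fresh variable.\<close>

primrec ex_fm :: "vocab \<Rightarrow> 'a struct \<Rightarrow> nat \<Rightarrow> nat \<Rightarrow> (nat \<Rightarrow> 'a) \<Rightarrow> fm" where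
  "ex_fm L M 0 m a = conjs (diagram L M m a)"
| "ex_fm L M (Suc j) m a =
     conjs (map (\<lambda>c. Ex m (ex_fm L M j (Suc m) (a(m := c)))) (enum_set (univ M)))"

text \<open>Spoiler now plays in the structure on which the formula is evaluated, so the moves
  become universal quantifiers and the answers in \<open>M\<close> a disjunction.\<close>

primrec all_fm :: "vocab \<Rightarrow> 'a struct \<Rightarrow> nat \<Rightarrow> nat \<Rightarrow> (nat \<Rightarrow> 'a) \<Rightarrow> fm" where
  "all_fm L M 0 m a = conjs (diagram L M m a)"
| "all_fm L M (Suc j) m a =
     All m (disjs (map (\<lambda>c. all_fm L M j (Suc m) (a(m := c))) (enum_set (univ M))))"

lemma image_pairs_upd:
  "(\<lambda>i. ((a(m := c)) i, (e(m := d)) i)) ` {..<Suc m} = insert (c, d) ((\<lambda>i. (a i, e i)) ` {..<m})"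
  by (auto simp: lessThan_Suc)

lemma sim_0_converse: "sim L M N 0 P \<Longrightarrow> sim L N M 0 (P\<inverse>)"
proof -
  assume P: "sim L M N 0 P"
  have "rel N R (map fst ps) \<longleftrightarrow> rel M R (map snd ps)"
    if "R < length L" "length ps = L ! R" "set ps \<subseteq> P\<inverse>" for R ps
  proof -
    have "set (map prod.swap ps) \<subseteq> P" using that(3) by auto
    then show ?thesis
      using sim_0_rel[OF P that(1), of "map prod.swap ps"] that(2) by (simp add: comp_def)
  qed
  moreover have "a = c \<longleftrightarrow> b = d" if "(a, b) \<in> P\<inverse>" "(c, d) \<in> P\<inverse>" for a b c d
    using sim_0_eq[OF P] that by blast
  ultimately show ?thesis by (intro sim_0I)
qed

lemma converse_pairs: "((\<lambda>i. (f i, g i)) ` A)\<inverse> = (\<lambda>i. (g i, f i)) ` A"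
  by auto

context
  fixes L :: vocab and M :: "'a struct"
  assumes fin: "finite (univ M)" and ne: "univ M \<noteq> {}"
begin

lemma sat_ex_fm:
  "0 < m + j \<Longrightarrow> sat N e (ex_fm L M j m a) \<longleftrightarrow> sim L M N j ((\<lambda>i. (a i, e i)) ` {..<m})"
proof (induction j arbitrary: m e a)
  case 0
  then show ?case using sat_diagram by simp
next
  case (Suc j)
  have "sat N e (ex_fm L M (Suc j) m a) \<longleftrightarrow>
      (\<forall>c\<in>univ M. \<exists>d\<in>univ N. sat N (e(m := d)) (ex_fm L M j (Suc m) (a(m := c))))"
    using enum_set_nonempty[OF fin ne] by (simp add: conjs_simps set_enum_set[OF fin])
  then show ?case by (simp add: Suc.IH image_pairs_upd del: fun_upd_apply)
qed

lemma sat_all_fm: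
  "0 < m + j \<Longrightarrow> sat N e (all_fm L M j m a) \<longleftrightarrow> sim L N M j ((\<lambda>i. (e i, a i)) ` {..<m})"
proof (induction j arbitrary: m e a)
  case 0
  then have "sat N e (all_fm L M 0 m a) \<longleftrightarrow> sim L M N 0 ((\<lambda>i. (a i, e i)) ` {..<m})"
    using sat_diagram by simp
  \<comment> \<open>A final position can be read in both directions, so the same diagram serves both
    kinds of formulas.\<close>
  also have "\<dots> \<longleftrightarrow> sim L N M 0 ((\<lambda>i. (e i, a i)) ` {..<m})"
    using sim_0_converse[of L M N "(\<lambda>i. (a i, e i)) ` {..<m}"]
      sim_0_converse[of L N M "(\<lambda>i. (e i, a i)) ` {..<m}"]
    unfolding converse_pairs by blast
  finally show ?case .
next
  case (Suc j)
  have "sat N e (all_fm L M (Suc j) m a) \<longleftrightarrow>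
      (\<forall>d\<in>univ N. \<exists>c\<in>univ M. sat N (e(m := d)) (all_fm L M j (Suc m) (a(m := c))))"
    using enum_set_nonempty[OF fin ne] by (simp add: disjs_simps set_enum_set[OF fin])
  then show ?case by (simp add: Suc.IH image_pairs_upd del: fun_upd_apply)
qed

lemma diagram_syntax:
  assumes "0 < m"
  shows "wf_fm L (conjs (diagram L M m a))" "free_vars (conjs (diagram L M m a)) \<subseteq> {..<m}"
    "nest (conjs (diagram L M m a)) = {[]}"
proof -
  note ne = diagram_nonempty[OF assms, of L M a]
  show "wf_fm L (conjs (diagram L M m a))" "free_vars (conjs (diagram L M m a)) \<subseteq> {..<m}"
    unfolding conjs_simps(2,3)[OF ne] set_diagram by (auto simp: lit_simps)
  have "nest \<phi> = {[]}" if "\<phi> \<in> set (diagram L M m a)" for \<phi>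
    using that unfolding set_diagram by (auto simp: lit_simps)
  then show "nest (conjs (diagram L M m a)) = {[]}"
    unfolding conjs_simps(4)[OF ne] using ne by (cases "diagram L M m a") auto
qed

lemma ex_fm_syntax:
  "0 < m + j \<Longrightarrow> wf_fm L (ex_fm L M j m a) \<and> free_vars (ex_fm L M j m a) \<subseteq> {..<m} \<and>
     nest (ex_fm L M j m a) = {replicate j QEx}"
proof (induction j arbitrary: m a)
  case 0
  then show ?case using diagram_syntax by simp
next
  case (Suc j)
  have "wf_fm L (ex_fm L M j (Suc m) b)" "free_vars (ex_fm L M j (Suc m) b) - {m} \<subseteq> {..<m}"
    "nest (ex_fm L M j (Suc m) b) = {replicate j QEx}" for b
    using Suc.IH[of "Suc m" b] by (auto simp: lessThan_Suc)
  then show ?case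
    using enum_set_nonempty[OF fin ne] ne
    by (simp add: conjs_simps set_enum_set[OF fin]) blast
qed

lemma all_fm_syntax:
  "0 < m + j \<Longrightarrow> wf_fm L (all_fm L M j m a) \<and> free_vars (all_fm L M j m a) \<subseteq> {..<m} \<and>
     nest (all_fm L M j m a) = {replicate j QAll}"
proof (induction j arbitrary: m a)
  case 0
  then show ?case using diagram_syntax by simp
next
  case (Suc j)
  have "wf_fm L (all_fm L M j (Suc m) b)" "free_vars (all_fm L M j (Suc m) b) - {m} \<subseteq> {..<m}"
    "nest (all_fm L M j (Suc m) b) = {replicate j QAll}" for b
    using Suc.IH[of "Suc m" b] by (auto simp: lessThan_Suc)
  then show ?case
    using enum_set_nonempty[OF fin ne] ne
    by (simp add: disjs_simps set_enum_set[OF fin]) blast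
qed

end

section \<open>Existential prefix and rank of the defining formula\<close>

lemma exs_syntax:
  "wf_fm L (foldr Ex [0..<p] \<phi>) = wf_fm L \<phi>"
  "free_vars (foldr Ex [0..<p] \<phi>) = free_vars \<phi> - {..<p}"
  "nest (foldr Ex [0..<p] \<phi>) = (@) (replicate p QEx) ` nest \<phi>"
proof (induction p arbitrary: \<phi>)
  case (Suc p)
  { case 1 show ?case using Suc by simp }
  { case 2 show ?case using Suc by (auto simp: lessThan_Suc) }
  { case 3 show ?case using Suc by (auto simp: image_image replicate_app_Cons_same) }
qed auto

lemma sat_exs:
  "sat N e (foldr Ex [0..<p] \<phi>) \<longleftrightarrow>
     (\<exists>f. (\<forall>i<p. f i \<in> univ N) \<and> sat N (\<lambda>i. if i < p then f i else e i) \<phi>)"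
proof (induction p arbitrary: \<phi>)
  case (Suc p)
  have upd: "(\<lambda>i. if i < p then f i else e i)(p := d) =
      (\<lambda>i. if i < Suc p then (f(p := d)) i else e i)" for f d
    by (auto simp: fun_eq_iff)
  \<comment> \<open>The quantifier of \<open>p\<close> is the innermost one, so the induction
    hypothesis is used for \<open>Ex p \<phi>\<close>.\<close>
  have "sat N e (foldr Ex [0..<Suc p] \<phi>) \<longleftrightarrow>
      (\<exists>f. (\<forall>i<p. f i \<in> univ N) \<and> (\<exists>d\<in>univ N. sat N (\<lambda>i. if i < Suc p then (f(p := d)) i else e i) \<phi>))"
    using Suc[of "Ex p \<phi>"] by (simp only: upt_Suc_append le0 foldr_append foldr.simps id_o comp_def sat.simps upd id_apply)
  also have "\<dots> \<longleftrightarrow> (\<exists>f. (\<forall>i<Suc p. f i \<in> univ N) \<and> sat N (\<lambda>i. if i < Suc p then f i else e i) \<phi>)"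
  proof (intro iffI; elim exE conjE bexE)
    fix f d assume "\<forall>i<p. f i \<in> univ N" "d \<in> univ N" "sat N (\<lambda>i. if i < Suc p then (f(p := d)) i else e i) \<phi>"
    then show "\<exists>f. (\<forall>i<Suc p. f i \<in> univ N) \<and> sat N (\<lambda>i. if i < Suc p then f i else e i) \<phi>"
      by (intro exI[of _ "f(p := d)"]) (auto simp: less_Suc_eq)
  next
    fix f assume f: "\<forall>i<Suc p. f i \<in> univ N" "sat N (\<lambda>i. if i < Suc p then f i else e i) \<phi>"
    then show "\<exists>f. (\<forall>i<p. f i \<in> univ N) \<and> (\<exists>d\<in>univ N. sat N (\<lambda>i. if i < Suc p then (f(p := d)) i else e i) \<phi>)"
      by (intro exI[of _ f] conjI bexI[of _ "f p"]) (simp_all only: fun_upd_triv, auto)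
  qed
  finally show ?case .
qed simp

lemma alternations_replicate: "alternations (replicate p x @ replicate q y) \<le> 1"
proof -
  \<comment> \<open>The letter can change only at the border of the two blocks.\<close>
  have "{i. Suc i < length (replicate p x @ replicate q y) \<and>
      (replicate p x @ replicate q y) ! i \<noteq> (replicate p x @ replicate q y) ! Suc i} \<subseteq> {p - 1}"
    by (auto simp: nth_append split: if_splits)
  then show ?thesis unfolding alternations_def by (rule order_trans[OF card_mono, rotated]) simp_all
qed

text \<open>A prefix of \<open>p\<close> existential quantifiers names the \<open>a i\<close>, and
  the conjunction of the two game formulas follows it. This gives one existential word and one with
  a single block of universal letters at its end, both of length \<open>p + K\<close>. In
  \<open>N\<close>, the witnesses of the prefix are the \<open>b i\<close>.\<close>

lemma D1_le:
  assumes M: "is_struct L M" and ne: "univ M \<noteq> {}" and K: "0 < K"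
    and a: "\<And>i. i < p \<Longrightarrow> a i \<in> univ M"
    and iso: "\<And>(N :: nat struct) b. is_struct L N \<Longrightarrow> (\<And>i. i < p \<Longrightarrow> b i \<in> univ N) \<Longrightarrow>
      sim L M N K ((\<lambda>i. (a i, b i)) ` {..<p}) \<Longrightarrow> sim L N M K ((\<lambda>i. (b i, a i)) ` {..<p}) \<Longrightarrow>
      isomorphic L M N"
  shows "D1 L M \<le> p + K"
proof -
  have fin: "finite (univ M)" using M by (simp add: is_struct_def)
  define \<psi> where "\<psi> = Conj (ex_fm L M K p a) (all_fm L M K p a)"
  define \<phi> where "\<phi> = foldr Ex [0..<p] \<psi>"
  have pK: "0 < p + K" using K by simp
  note syn = ex_fm_syntax[OF fin ne pK, of L a] all_fm_syntax[OF fin ne pK, of L a]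
  have nest: "nest \<phi> = {replicate p QEx @ replicate K QEx, replicate p QEx @ replicate K QAll}"
    using syn by (simp add: \<phi>_def \<psi>_def exs_syntax insert_commute)
  \<comment> \<open>The type of \<open>N\<close> is left open because this is used both for
    \<open>M\<close> and for structures on \<open>nat\<close>.\<close>
  have sat: "sat N (\<lambda>i. if i < p then b i else e i) \<psi> \<longleftrightarrow>
      sim L M N K ((\<lambda>i. (a i, b i)) ` {..<p}) \<and> sim L N M K ((\<lambda>i. (b i, a i)) ` {..<p})"
    for N :: "'c struct" and b e
  proof -
    have "(\<lambda>i. (a i, if i < p then b i else e i)) ` {..<p} = (\<lambda>i. (a i, b i)) ` {..<p}"
      "(\<lambda>i. (if i < p then b i else e i, a i)) ` {..<p} = (\<lambda>i. (b i, a i)) ` {..<p}"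
      by auto
    then show ?thesis by (simp add: \<psi>_def sat_ex_fm[OF fin ne pK] sat_all_fm[OF fin ne pK])
  qed
  have "true_on M \<phi>"
    unfolding true_on_def \<phi>_def sat_exs sat using a by (auto intro!: exI[of _ a] sim_refl)
  moreover have "isomorphic L M N" if "is_struct L N" "true_on N \<phi>" for N :: "nat struct"
    using that iso unfolding true_on_def \<phi>_def sat_exs sat by blast
  moreover have "closed_fm L \<phi>"
    using syn by (auto simp: closed_fm_def \<phi>_def \<psi>_def exs_syntax)
  ultimately have "defines_struct L \<phi> M" unfolding defines_struct_def by blast
  moreover have "alternation_number \<phi> \<le> 1"
    using alternations_replicate by (simp add: alternation_number_def nest)
  moreover have "quantifier_rank \<phi> = p + K" by (simp add: quantifier_rank_def nest)
  ultimately show ?thesis unfolding D1_def by (intro Least_le) blast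
qed


section \<open>Types over a set of elements\<close>

text \<open>In the tuples \<open>t\<close>, the entry \<open>None\<close> stands for the element \<open>u\<close>.\<close>

definition ty :: "vocab \<Rightarrow> 'a struct \<Rightarrow> 'a set \<Rightarrow> 'a \<Rightarrow> (nat \<times> 'a option list) set" where
  "ty L M W u = {(R, t). R < length L \<and> length t = L ! R \<and> set t \<subseteq> insert None (Some ` W) \<and>
     rel M R (map (case_option u id) t)}"

lemma ty_restrict: "S \<subseteq> W \<Longrightarrow> ty L M S u = ty L M W u \<inter> {(R, t). set t \<subseteq> insert None (Some ` S)}"
  unfolding ty_def by blast

lemma ty_mono: "S \<subseteq> W \<Longrightarrow> ty L M W u = ty L M W w \<Longrightarrow> ty L M S u = ty L M S w"
  by (simp add: ty_restrict)

text \<open>A difference between two types shows in a single atomic formula with at most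
  \<open>k\<close> places, one of which is taken by the element itself. Its parameters form
  \<open>S\<close>.\<close>

lemma ty_neq_small:
  assumes "ty L M W u \<noteq> ty L M W w" "\<And>R. R < length L \<Longrightarrow> L ! R \<le> k"
  shows "\<exists>S\<subseteq>W. finite S \<and> card S \<le> k - 1 \<and> ty L M S u \<noteq> ty L M S w"
proof -
  obtain R t where t: "((R, t) \<in> ty L M W u) \<noteq> ((R, t) \<in> ty L M W w)"
    using assms(1) by (auto simp: set_eq_iff)
  define S where "S = {x. Some x \<in> set t}"
  have RL: "R < length L" "length t = L ! R" and tW: "set t \<subseteq> insert None (Some ` W)"
    using t by (auto simp: ty_def)
  have S: "Some ` S = set t - {None}" unfolding S_def
    by (auto simp: image_iff) (metis not_None_eq)
  have "None \<in> set t"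
  proof (rule ccontr)
    assume "None \<notin> set t"
    then have "map (case_option u id) t = map (case_option w id) t"
      by (auto split: option.split)
    then show False using t unfolding ty_def by (simp del: map_eq_conv)
  qed
  then have "card (set t - {None}) = card (set t) - 1" by simp
  moreover have "card (set t) \<le> k" using card_length[of t] RL assms(2) by fastforce
  moreover have "card (Some ` S) = card S" by (simp add: card_image)
  ultimately have "card S \<le> k - 1" using S by simp
  moreover have "finite S" by (rule finite_imageD[of Some]) (simp_all add: S)
  moreover have "S \<subseteq> W" using tW unfolding S_def by auto
  moreover have "set t \<subseteq> insert None (Some ` S)" using S by auto
  then have "ty L M S u \<noteq> ty L M S w" using t RL tW by (auto simp: ty_def)
  ultimately show ?thesis by blast
qed

text \<open>The tuple is read as an atomic formula over its entries other than \<open>a\<close>,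
  with \<open>None\<close> at each occurrence of \<open>a\<close>.\<close>

lemma rel_replace:
  assumes "ty L M (set t - {a}) a = ty L M (set t - {a}) d" "R < length L" "length t = L ! R"
  shows "rel M R t \<longleftrightarrow> rel M R (map (\<lambda>x. if x = a then d else x) t)"
proof -
  define t' where "t' = map (\<lambda>x. if x = a then None else Some x) t"
  have "set t' \<subseteq> insert None (Some ` (set t - {a}))" by (auto simp: t'_def)
  moreover have "map (case_option a id) t' = t" "map (case_option d id) t' = map (\<lambda>x. if x = a then d else x) t"
    by (auto simp: t'_def intro: map_idI)
  moreover have "length t' = L ! R" using assms(3) by (simp add: t'_def)
  ultimately have "(R, t') \<in> ty L M (set t - {a}) a \<longleftrightarrow> rel M R t"
    "(R, t') \<in> ty L M (set t - {a}) d \<longleftrightarrow> rel M R (map (\<lambda>x. if x = a then d else x) t)"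
    using assms(2) by (simp_all add: ty_def del: map_eq_conv)
  then show ?thesis using assms(1) by simp
qed

text \<open>The right-hand side does not mention \<open>u\<close>. Hence two elements matched with
  the same \<open>z\<close>, for the same \<open>h\<close> on the parameters, have the same type
  over \<open>S\<close>.\<close>

lemma sim_0_ty:
  assumes "sim L N M 0 P" "(z, u) \<in> P" "\<And>s. s \<in> S \<Longrightarrow> (h s, s) \<in> P"
  shows "ty L M S u = {(R, t). R < length L \<and> length t = L ! R \<and> set t \<subseteq> insert None (Some ` S) \<and>
     rel N R (map (case_option z h) t)}"
proof -
  have "rel M R (map (case_option u id) t) \<longleftrightarrow> rel N R (map (case_option z h) t)"
    if "R < length L" "length t = L ! R" "set t \<subseteq> insert None (Some ` S)" for R t
  proof -
    let ?ps = "map (\<lambda>x. (case_option z h x, case_option u id x)) t"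
    have "set ?ps \<subseteq> P" using that(3) assms(2,3) by (auto split: option.splits)
    then show ?thesis using sim_0_rel[OF assms(1) that(1), of ?ps] that(2) by (simp add: comp_def)
  qed
  then show ?thesis unfolding ty_def by blast
qed

section \<open>Layered separating sets\<close>

locale irredundant_struct =
  fixes L :: vocab and M :: "'a struct" and k :: nat
  assumes fin: "finite (univ M)"
    and irr: "irredundant L M"
    and arity: "\<And>R. R < length L \<Longrightarrow> L ! R \<le> k"
    and k_pos: "0 < k"
begin

abbreviation V :: "'a set" where "V \<equiv> univ M"
abbreviation tp :: "'a set \<Rightarrow> 'a \<Rightarrow> (nat \<times> 'a option list) set" where "tp \<equiv> ty L M"

definition num_classes :: "'a set \<Rightarrow> nat" where
  "num_classes W = card (tp W ` (V - W))"

definition cls :: "'a set \<Rightarrow> 'a \<Rightarrow> 'a set" where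
  "cls W v = {w \<in> V - W. tp W w = tp W v}"

definition small :: "'a set \<Rightarrow> 'a set" where
  "small W = {v \<in> V - W. card (cls W v) \<le> k}"

text \<open>No move (a) is left at \<open>W\<close>.\<close>

definition saturated :: "'a set \<Rightarrow> bool" where
  "saturated W \<longleftrightarrow> (\<forall>S\<subseteq>V. card S < k \<longrightarrow> num_classes (W \<union> S) \<le> num_classes W)"

text \<open>Otherwise swapping two elements of \<open>A\<close> would be an automorphism. Replacing
  one element of \<open>A\<close> in a tuple by another one that does not occur preserves the
  relations, because the other entries are at most \<open>k - 1\<close> parameters; and
  \<open>A\<close> has a spare element outside any tuple.\<close>

lemma no_indiscernible_set:
  assumes A: "A \<subseteq> V" "k < card A"
    and ind: "\<And>S a b. S \<subseteq> V \<Longrightarrow> card S < k \<Longrightarrow> a \<in> A - S \<Longrightarrow> b \<in> A - S \<Longrightarrow> tp S a = tp S b"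
  shows False
proof -
  let ?r = "\<lambda>x y. \<lambda>v. if v = x then y else v"
  have "\<not> is_singleton A" "A \<noteq> {}" using A(2) k_pos by (auto simp: is_singleton_altdef)
  then obtain a b where ab: "a \<in> A" "b \<in> A" "a \<noteq> b"
    by (meson is_singletonI' )
  have bij: "bij_betw (transpose a b) V V"
    using ab A(1) by (simp add: subset_iff)
  have "\<not> automorphism L (transpose a b) M"
    using irr ab A(1) by (auto simp: irredundant_def)
  then obtain R t where R: "R < length L" and t: "t \<in> tuples M (L ! R)"
    and neq: "rel M R t \<noteq> rel M R (map (transpose a b) t)"
    using bij unfolding automorphism_def iso_def by blast
  have replace: "rel M R s \<longleftrightarrow> rel M R (map (?r x y) s)"
    if s: "set s \<subseteq> V" "length s = L ! R" "x \<in> A" "y \<in> A" "y \<notin> set s" for s x y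
  proof (cases "x \<in> set s")
    case False
    then have "map (?r x y) s = s" by (auto intro: map_idI)
    then show ?thesis by simp
  next
    case True
    have "card (set s) \<le> k" using card_length[of s] s(2) arity[OF R] by simp
    then have "card (set s - {x}) < k" using True k_pos by (simp add: card_Diff_singleton)
    then have "tp (set s - {x}) x = tp (set s - {x}) y"
      using s by (intro ind) auto
    from rel_replace[OF this R s(2)] show ?thesis .
  qed
  have t: "set t \<subseteq> V" "length t = L ! R" using t by (auto simp: tuples_def)
  consider "b \<notin> set t" | "a \<notin> set t" | "a \<in> set t" "b \<in> set t" by blast
  then show False
  proof cases
    case 1
    then have "map (transpose a b) t = map (?r a b) t" by (auto simp: transpose_def)
    then show False using neq replace[OF t ab(1,2)] 1 by (simp del: map_eq_conv)
  next
    case 2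
    then have "map (transpose a b) t = map (?r b a) t" by (auto simp: transpose_def)
    then show False using neq replace[OF t ab(2,1)] 2 by (simp del: map_eq_conv)
  next
    case 3
    have "card (set t) < card A" using card_length[of t] t(2) arity[OF R] A(2) by simp
    then have "\<not> A \<subseteq> set t" using card_mono[of "set t" A] by auto
    then obtain c where c: "c \<in> A" "c \<notin> set t" by blast
    \<comment> \<open>Perform the transposition in three replacements, using \<open>c\<close> as a temporary place.\<close>
    define t1 where "t1 = map (?r a c) t"
    define t2 where "t2 = map (?r b a) t1"
    have V: "a \<in> V" "b \<in> V" "c \<in> V" using ab c A(1) by auto
    have s1: "set t1 \<subseteq> V" "length t1 = L ! R" "a \<notin> set t1" using t V c ab 3 by (auto simp: t1_def)
    have s2: "set t2 \<subseteq> V" "length t2 = L ! R" "b \<notin> set t2" using s1 V ab by (auto simp: t2_def)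
    have "map (?r c b) t2 = map (transpose a b) t"
      using c(2) ab(3) 3 by (auto simp: t2_def t1_def transpose_def)
    moreover have "rel M R t \<longleftrightarrow> rel M R t1" using replace[OF t ab(1) c] by (simp add: t1_def)
    moreover have "rel M R t1 \<longleftrightarrow> rel M R t2" using replace[OF s1(1,2) ab(2,1) s1(3)] by (simp add: t2_def)
    moreover have "rel M R t2 \<longleftrightarrow> rel M R (map (?r c b) t2)" using replace[OF s2(1,2) c(1) ab(2) s2(3)] .
    ultimately show False using neq by (simp del: map_eq_conv)
  qed
qed

section \<open>Refinement of types and saturated sets\<close>

lemma tp_image_restrict:
  "W \<subseteq> W' \<Longrightarrow> tp W ` D = (\<lambda>X. X \<inter> {(R, t). set t \<subseteq> insert None (Some ` W)}) ` tp W' ` D"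
  by (simp add: ty_restrict image_image)

lemma card_tp_mono: "W \<subseteq> W' \<Longrightarrow> D \<subseteq> V \<Longrightarrow> card (tp W ` D) \<le> card (tp W' ` D)"
  unfolding tp_image_restrict[of W W'] by (intro card_image_le finite_imageI finite_subset[OF _ fin])

text \<open>Restriction maps the types over \<open>W \<union> S\<close> onto those over
  \<open>W\<close>, because \<open>S\<close> swallows no class. The map is not injective, as it
  merges the types of \<open>a\<close> and \<open>b\<close>.\<close>

lemma split_increases:
  assumes W: "W \<subseteq> V" and S: "S \<subseteq> V"
    and ab: "a \<in> V - W - S" "b \<in> V - W - S" "tp W a = tp W b" "tp S a \<noteq> tp S b"
    and meet: "\<And>v. v \<in> V - W \<Longrightarrow> \<exists>v'\<in>V - W - S. tp W v' = tp W v"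
  shows "num_classes W < num_classes (W \<union> S)"
proof -
  let ?D = "V - (W \<union> S)"
  let ?F = "\<lambda>X :: (nat \<times> 'a option list) set. X \<inter> {(R, t). set t \<subseteq> insert None (Some ` W)}"
  have D: "V - W - S = ?D" by blast
  have "tp W ` (V - W) = tp W ` ?D" using meet unfolding D by (auto simp: image_iff) metis
  then have eq: "tp W ` (V - W) = ?F ` tp (W \<union> S) ` ?D" using tp_image_restrict[of W "W \<union> S" ?D] by simp
  have finD: "finite (tp (W \<union> S) ` ?D)" using fin by simp
  have "\<not> inj_on ?F (tp (W \<union> S) ` ?D)"
  proof
    assume "inj_on ?F (tp (W \<union> S) ` ?D)"
    moreover have "?F (tp (W \<union> S) a) = ?F (tp (W \<union> S) b)"
      using ab(3) ty_restrict[of W "W \<union> S" L M] by simp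
    ultimately have "tp (W \<union> S) a = tp (W \<union> S) b" using ab(1,2) unfolding D by (auto dest: inj_onD)
    then show False using ab(4) ty_mono[of S "W \<union> S"] by blast
  qed
  then have "card (?F ` tp (W \<union> S) ` ?D) < card (tp (W \<union> S) ` ?D)"
    using card_image_le[OF finD] eq_card_imp_inj_on[OF finD] by (metis le_neq_implies_less)
  then show ?thesis unfolding num_classes_def eq .
qed

text \<open>Otherwise \<open>S\<close> would be a move (a). It swallows no class: those of at most
  \<open>k\<close> elements lie in \<open>small W\<close>, which it misses, and the others are
  larger than \<open>S\<close>.\<close>

lemma saturated_hits_small:
  assumes "saturated W" and W: "W \<subseteq> V" and S: "S \<subseteq> V" "card S < k"
    and ab: "a \<in> V - W - S" "b \<in> V - W - S" "tp W a = tp W b" "tp S a \<noteq> tp S b"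
  shows "S \<inter> small W \<noteq> {}"
proof
  assume disj: "S \<inter> small W = {}"
  have "\<exists>v'\<in>V - W - S. tp W v' = tp W v" if v: "v \<in> V - W" for v
  proof (cases "v \<in> small W")
    case True
    then show ?thesis using v disj by blast
  next
    case False
    then have "card S < card (cls W v)" using v S(2) by (simp add: small_def)
    then have "\<not> cls W v \<subseteq> S" using card_mono[of S "cls W v"] finite_subset[OF S(1) fin] by auto
    then show ?thesis by (auto simp: cls_def)
  qed
  from split_increases[OF W S(1) ab this] show False
    using assms(1) S by (auto simp: saturated_def not_le)
qed

text \<open>Each move (a) adds at most \<open>k - 1\<close> elements and gains at least one class,
  so the new elements are charged to new classes.\<close>

lemma exists_saturated:
  "W \<subseteq> V \<Longrightarrow> \<exists>E\<subseteq>V - W. saturated (W \<union> E) \<and>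
     card E + (k - 1) * num_classes W \<le> (k - 1) * num_classes (W \<union> E)"
proof (induction "card (V - W)" arbitrary: W rule: less_induct)
  case less
  show ?case
  proof (cases "saturated W")
    case True
    then show ?thesis by (intro exI[of _ "{}"]) simp
  next
    case False
    then obtain S where S: "S \<subseteq> V" "card S < k" "num_classes W < num_classes (W \<union> S)"
      by (auto simp: saturated_def not_le)
    \<comment> \<open>A subset of \<open>W\<close> would leave the number of classes
      unchanged.\<close>
    then have "S - W \<noteq> {}" by (metis Diff_eq_empty_iff Un_absorb2 less_irrefl)
    then have "V - (W \<union> S) \<subset> V - W" using S(1) by blast
    then have "card (V - (W \<union> S)) < card (V - W)" using fin by (intro psubset_card_mono) auto
    then obtain E where E: "E \<subseteq> V - (W \<union> S)" "saturated (W \<union> S \<union> E)"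
      "card E + (k - 1) * num_classes (W \<union> S) \<le> (k - 1) * num_classes (W \<union> S \<union> E)"
      using less.hyps[of "W \<union> S"] less.prems S(1) by blast
    have un: "W \<union> (S - W \<union> E) = W \<union> S \<union> E" by blast
    have "finite S" using S(1) fin finite_subset by blast
    then have "card (S - W \<union> E) \<le> card S + card E"
      by (meson Diff_subset add_le_mono1 card_Un_le card_mono le_trans)
    moreover have "(k - 1) * Suc (num_classes W) \<le> (k - 1) * num_classes (W \<union> S)"
      using S(3) by (intro mult_le_mono2) simp
    ultimately have "card (S - W \<union> E) + (k - 1) * num_classes W \<le> (k - 1) * num_classes (W \<union> S \<union> E)"
      using E(3) S(2) by simp
    then show ?thesis using E S(1) un by (intro exI[of _ "S - W \<union> E"]) auto
  qed
qed

text \<open>Level \<open>0\<close> is \<open>X\<close>; every other element of \<open>W\<close> is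
  determined by its type over the lower levels, even against elements outside \<open>W\<close>. The
  last clause is the running account: moves (a) are paid by new classes, and an absorbed class by
  its representative. The latter counts twice, for up to \<open>k - 1\<close> elements put into
  \<open>X\<close> and for the loss of a class.\<close>

definition layered :: "'a set \<Rightarrow> 'a set \<Rightarrow> ('a \<Rightarrow> nat) \<Rightarrow> nat \<Rightarrow> bool" where
  "layered W X lev i \<longleftrightarrow> X \<subseteq> W \<and> W \<subseteq> V \<and> (\<forall>v\<in>W. lev v \<le> i \<and> (lev v = 0 \<longleftrightarrow> v \<in> X)) \<and>
     (\<forall>u\<in>W - X. \<forall>w\<in>V. w \<noteq> u \<longrightarrow> w \<notin> {v \<in> W. lev v < lev u} \<longrightarrow>
        tp {v \<in> W. lev v < lev u} u \<noteq> tp {v \<in> W. lev v < lev u} w) \<and>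
     card X + (k - 1) \<le> (k - 1) * (2 * card (W - X) + num_classes W)"

lemma layered_sep:
  "layered W X lev i \<Longrightarrow> u \<in> W - X \<Longrightarrow> w \<in> V \<Longrightarrow> w \<noteq> u \<Longrightarrow> w \<notin> {v \<in> W. lev v < lev u} \<Longrightarrow>
   tp {v \<in> W. lev v < lev u} u \<noteq> tp {v \<in> W. lev v < lev u} w"
  unfolding layered_def by blast

text \<open>New elements get level \<open>0\<close>, so the sets of lower elements only grow and
  types over them become finer.\<close>

lemma layered_add:
  assumes lay: "layered W X lev i" and E: "E \<subseteq> V - W"
    "card E + (k - 1) * num_classes W \<le> (k - 1) * num_classes (W \<union> E)"
  shows "layered (W \<union> E) (X \<union> E) (\<lambda>v. if v \<in> E then 0 else lev v) i"
proof -
  let ?lev = "\<lambda>v. if v \<in> E then 0 else lev v"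
  have WX: "X \<subseteq> W" "W \<subseteq> V" "\<And>v. v \<in> W \<Longrightarrow> lev v \<le> i \<and> (lev v = 0 \<longleftrightarrow> v \<in> X)"
    and bound: "card X + (k - 1) \<le> (k - 1) * (2 * card (W - X) + num_classes W)"
    using lay by (auto simp: layered_def)
  have "tp {v \<in> W \<union> E. ?lev v < ?lev u} u \<noteq> tp {v \<in> W \<union> E. ?lev v < ?lev u} w"
    if u: "u \<in> W \<union> E - (X \<union> E)" "w \<in> V" "w \<noteq> u" "w \<notin> {v \<in> W \<union> E. ?lev v < ?lev u}" for u w
  proof -
    have sub: "{v \<in> W. lev v < lev u} \<subseteq> {v \<in> W \<union> E. ?lev v < ?lev u}" using u(1) by auto
    then have "tp {v \<in> W. lev v < lev u} u \<noteq> tp {v \<in> W. lev v < lev u} w"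
      using u by (intro layered_sep[OF lay]) auto
    then show ?thesis using ty_mono[OF sub] by blast
  qed
  moreover have "W \<union> E - (X \<union> E) = W - X" using E(1) WX by blast
  moreover have "card (X \<union> E) \<le> card X + card E" by (rule card_Un_le)
  ultimately show ?thesis
    using WX E bound unfolding layered_def by (auto simp: distrib_left)
qed

text \<open>Representatives \<open>U\<close> of the small classes form the new top level, and the
  other members of these classes go to level \<open>0\<close>. An element outside \<open>W\<close>
  with the same type over \<open>W\<close> as a representative is in its class, so it is the
  representative itself or of lower level.\<close>

lemma layered_absorb:
  assumes lay: "layered W X lev i"
  shows "\<exists>X' lev'. layered (W \<union> small W) X' lev' (Suc i)"
proof -
  have WX: "X \<subseteq> W" "W \<subseteq> V" "\<And>v. v \<in> W \<Longrightarrow> lev v \<le> i \<and> (lev v = 0 \<longleftrightarrow> v \<in> X)"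
    and bound: "card X + (k - 1) \<le> (k - 1) * (2 * card (W - X) + num_classes W)"
    using lay by (auto simp: layered_def)
  \<comment> \<open>Choosing from the set \<open>cls W v\<close> makes \<open>r\<close> constant on
    classes, so \<open>U\<close> has exactly one element of each small class.\<close>
  define r where "r v = (SOME w. w \<in> cls W v)" for v
  define B where "B = small W"
  define U where "U = r ` B"
  have BV: "B \<subseteq> V - W" by (auto simp: B_def small_def)
  have finB: "finite B" using BV fin finite_subset by blast
  have cls_cong: "cls W v = cls W w" if "tp W v = tp W w" for v w using that by (simp add: cls_def)
  have r: "r v \<in> B \<and> tp W (r v) = tp W v" if "v \<in> B" for v
  proof -
    have "v \<in> cls W v" using that BV by (auto simp: cls_def)
    then have "r v \<in> cls W v" unfolding r_def by (rule someI)
    then show ?thesis using that cls_cong[of "r v" v] by (auto simp: B_def small_def cls_def)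
  qed
  have r_cong: "r v = r w" if "tp W v = tp W w" for v w unfolding r_def cls_cong[OF that] ..
  have UB: "U \<subseteq> B" using r by (auto simp: U_def)
  have rU: "r u = u" if "u \<in> U" for u using that r r_cong unfolding U_def by blast
  have U_inj: "u = w" if "u \<in> U" "w \<in> U" "tp W u = tp W w" for u w
    using that r_cong rU by metis
  have finU: "finite U" using UB finB finite_subset by blast
  define X' where "X' = X \<union> (B - U)"
  define lev' where "lev' v = (if v \<in> U then Suc i else if v \<in> B then 0 else lev v)" for v
  have sub: "W \<union> B - X' = (W - X) \<union> U" using UB BV WX by (auto simp: X'_def)
  have "card (cls W u - {u}) \<le> k - 1" if "u \<in> U" for u
  proof -
    have "u \<in> cls W u" "card (cls W u) \<le> k" using that UB BV by (auto simp: cls_def B_def small_def)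
    then show ?thesis by (simp add: card_Diff_singleton)
  qed
  then have "(\<Sum>u\<in>U. card (cls W u - {u})) \<le> card U * (k - 1)"
    using sum_bounded_above[of U "\<lambda>u. card (cls W u - {u})" "k - 1"] by simp
  moreover have "B - U \<subseteq> (\<Union>u\<in>U. cls W u - {u})"
  proof
    fix v assume v: "v \<in> B - U"
    then have "r v \<in> U" "v \<in> cls W (r v)" using r[of v] BV by (auto simp: U_def cls_def)
    moreover have "v \<noteq> r v"
    proof
      assume "v = r v"
      then have "v \<in> U" using \<open>r v \<in> U\<close> by simp
      then show False using v by simp
    qed
    ultimately show "v \<in> (\<Union>u\<in>U. cls W u - {u})" by (intro UN_I[of "r v"]) simp_all
  qed
  then have "card (B - U) \<le> card (\<Union>u\<in>U. cls W u - {u})"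
    using finU fin by (intro card_mono) (auto simp: cls_def)
  ultimately have cardB: "card (B - U) \<le> card U * (k - 1)"
    using card_UN_le[OF finU, of "\<lambda>u. cls W u - {u}"] by linarith
  \<comment> \<open>A class over \<open>W\<close> has a representative in \<open>U\<close> or keeps
    an element outside \<open>B\<close>.\<close>
  have "tp W ` (V - W) \<subseteq> tp W ` U \<union> tp W ` (V - (W \<union> B))"
  proof
    fix T assume "T \<in> tp W ` (V - W)"
    then obtain v where v: "v \<in> V - W" "T = tp W v" by blast
    show "T \<in> tp W ` U \<union> tp W ` (V - (W \<union> B))"
    proof (cases "v \<in> B")
      case True
      then have "r v \<in> U" "T = tp W (r v)" using r[of v] v(2) by (auto simp: U_def)
      then show ?thesis by blast
    qed (use v in blast)
  qed
  then have "num_classes W \<le> card (tp W ` U \<union> tp W ` (V - (W \<union> B)))"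
    unfolding num_classes_def using finU fin by (intro card_mono) auto
  also have "\<dots> \<le> card (tp W ` U) + card (tp W ` (V - (W \<union> B)))" by (rule card_Un_le)
  also have "\<dots> \<le> card U + num_classes (W \<union> B)"
    unfolding num_classes_def using card_image_le[OF finU] card_tp_mono[of W "W \<union> B" "V - (W \<union> B)"]
    by (intro add_mono) auto
  finally have ncl: "num_classes W \<le> card U + num_classes (W \<union> B)" .
  have "card (W \<union> B - X') = card (W - X) + card U" unfolding sub
    using UB BV finU WX(2) fin by (intro card_Un_disjoint) (auto intro: finite_subset)
  moreover have "card X' \<le> card X + card (B - U)" unfolding X'_def by (rule card_Un_le)
  ultimately have "card X' + (k - 1) \<le> (k - 1) * (2 * card (W - X) + num_classes W) + card U * (k - 1)"
    using bound cardB by linarith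
  also have "\<dots> \<le> (k - 1) * (2 * card (W - X) + (card U + num_classes (W \<union> B))) + card U * (k - 1)"
    using ncl by (intro add_right_mono mult_le_mono2) simp
  \<comment> \<open>Of the two copies of \<open>card U\<close>, one makes up for the lost classes
    and the other pays for \<open>B - U\<close>.\<close>
  also have "\<dots> = (k - 1) * (2 * card (W \<union> B - X') + num_classes (W \<union> B))"
    using \<open>card (W \<union> B - X') = card (W - X) + card U\<close> by (simp add: algebra_simps)
  finally have bound': "card X' + (k - 1) \<le> (k - 1) * (2 * card (W \<union> B - X') + num_classes (W \<union> B))" .
  have "tp {v \<in> W \<union> B. lev' v < lev' u} u \<noteq> tp {v \<in> W \<union> B. lev' v < lev' u} w"
    if u: "u \<in> W \<union> B - X'" "w \<in> V" "w \<noteq> u" "w \<notin> {v \<in> W \<union> B. lev' v < lev' u}" for u w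
  proof (cases "u \<in> U")
    case True
    have sub: "W \<subseteq> {v \<in> W \<union> B. lev' v < lev' u}"
      using True BV UB WX(3) by (auto simp: lev'_def less_Suc_eq_le)
    have "tp W u \<noteq> tp W w"
    proof
      assume eq: "tp W u = tp W w"
      have "w \<notin> W" using u(4) sub by blast
      then have "w \<in> B" using True UB u(2) eq cls_cong[OF eq] by (auto simp: B_def small_def)
      then have "w \<in> U" using u(4) True by (auto simp: lev'_def split: if_splits)
      then show False using U_inj True eq u(3) by blast
    qed
    then show ?thesis using ty_mono[OF sub] by blast
  next
    case False
    then have uW: "u \<in> W - X" using u(1) sub by blast
    then have "lev' u = lev u" using BV UB by (auto simp: lev'_def)
    then have sub: "{v \<in> W. lev v < lev u} \<subseteq> {v \<in> W \<union> B. lev' v < lev' u}"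
      using BV UB by (auto simp: lev'_def)
    then have "tp {v \<in> W. lev v < lev u} u \<noteq> tp {v \<in> W. lev v < lev u} w"
      using u uW by (intro layered_sep[OF lay]) auto
    then show ?thesis using ty_mono[OF sub] by blast
  qed
  moreover have "X' \<subseteq> W \<union> B" "W \<union> B \<subseteq> V" using WX BV by (auto simp: X'_def)
  moreover have "lev' v \<le> Suc i \<and> (lev' v = 0 \<longleftrightarrow> v \<in> X')" if "v \<in> W \<union> B" for v
    using that WX BV UB by (auto simp: lev'_def X'_def le_Suc_eq)
  ultimately have "layered (W \<union> B) X' lev' (Suc i)"
    using bound' unfolding layered_def by blast
  then show ?thesis unfolding B_def by blast
qed

text \<open>The invariant that limits the number of layers: after \<open>i\<close> of them, a
  separating set spends at least \<open>i\<close> of its fewer than \<open>k\<close> elements inside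
  \<open>W\<close>.\<close>

definition separators_meet :: "'a set \<Rightarrow> nat \<Rightarrow> bool" where
  "separators_meet W i \<longleftrightarrow> (\<forall>S a b. S \<subseteq> V \<longrightarrow> card S < k \<longrightarrow> a \<in> V - W - S \<longrightarrow> b \<in> V - W - S \<longrightarrow>
     tp W a = tp W b \<longrightarrow> tp S a \<noteq> tp S b \<longrightarrow> i \<le> card (S \<inter> W))"

lemma separators_meetD:
  "separators_meet W i \<Longrightarrow> S \<subseteq> V \<Longrightarrow> card S < k \<Longrightarrow> a \<in> V - W - S \<Longrightarrow> b \<in> V - W - S \<Longrightarrow>
   tp W a = tp W b \<Longrightarrow> tp S a \<noteq> tp S b \<Longrightarrow> i \<le> card (S \<inter> W)"
  unfolding separators_meet_def by blast

lemma exists_stage: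
  assumes "V \<noteq> {}"
  shows "\<exists>W X lev. layered W X lev i \<and> saturated W \<and> separators_meet W i"
proof (induction i)
  case 0
  \<comment> \<open>A class over the empty set pays for the summand \<open>k - 1\<close> in the
    account.\<close>
  have "0 < num_classes {}" using assms fin by (simp add: num_classes_def card_gt_0_iff)
  then have "layered {} {} (\<lambda>_. 0) 0" by (simp add: layered_def)
  moreover obtain E where E: "E \<subseteq> V - {}" "saturated ({} \<union> E)"
     "card E + (k - 1) * num_classes {} \<le> (k - 1) * num_classes ({} \<union> E)"
    using exists_saturated[of "{}"] by blast
  ultimately have "layered ({} \<union> E) ({} \<union> E) (\<lambda>v. if v \<in> E then 0 else 0) 0"
    by (intro layered_add)
  then show ?case using E(2) unfolding separators_meet_def by blast
next
  case (Suc i)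
  then obtain W X lev where lay: "layered W X lev i" and sat: "saturated W"
    and hits: "separators_meet W i"
    by blast
  obtain X' lev' where lay': "layered (W \<union> small W) X' lev' (Suc i)" using layered_absorb[OF lay] by blast
  then have "W \<union> small W \<subseteq> V" by (simp add: layered_def)
  then obtain E where E: "E \<subseteq> V - (W \<union> small W)" "saturated (W \<union> small W \<union> E)"
    "card E + (k - 1) * num_classes (W \<union> small W) \<le> (k - 1) * num_classes (W \<union> small W \<union> E)"
    using exists_saturated by blast
  let ?W = "W \<union> small W \<union> E"
  have "Suc i \<le> card (S \<inter> ?W)"
    if S: "S \<subseteq> V" "card S < k" and ab: "a \<in> V - ?W - S" "b \<in> V - ?W - S"
      "tp ?W a = tp ?W b" "tp S a \<noteq> tp S b" for S a b
  proof -
    have eq: "tp W a = tp W b" using ab(3) ty_mono[of W ?W] by blast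
    have "i \<le> card (S \<inter> W)" using separators_meetD[OF hits S _ _ eq ab(4)] ab(1,2) by blast
    \<comment> \<open>The new layer is disjoint from \<open>W\<close>, so meeting it raises the
      count.\<close>
    moreover have "S \<inter> small W \<noteq> {}"
      using saturated_hits_small[OF sat _ S _ _ eq ab(4)] ab(1,2) \<open>W \<union> small W \<subseteq> V\<close> by blast
    then have "S \<inter> W \<subset> S \<inter> ?W" by (auto simp: small_def)
    then have "card (S \<inter> W) < card (S \<inter> ?W)"
      using finite_subset[OF S(1) fin] by (intro psubset_card_mono) auto
    ultimately show ?thesis by simp
  qed
  then have "separators_meet ?W (Suc i)" unfolding separators_meet_def by (intro allI impI)
  then show ?case using layered_add[OF lay' E(1,3)] E(2) by blast
qed

text \<open>After \<open>k - 1\<close> layers a separating set would lie inside \<open>W\<close>,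
  and so could not separate elements of one class over \<open>W\<close>. The remaining classes are
  therefore indiscernible and have at most \<open>k\<close> elements, and one more absorption
  exhausts \<open>V\<close>.\<close>

lemma exists_layering:
  assumes "V \<noteq> {}"
  shows "\<exists>X lev. layered V X lev k"
proof -
  obtain W X lev where lay: "layered W X lev (k - 1)"
    and hits: "separators_meet W (k - 1)"
    using exists_stage[OF assms, of "k - 1"] by blast
  have ind: "tp S a = tp S b" if S: "S \<subseteq> V" "card S < k" and ab: "a \<in> V - W - S" "b \<in> V - W - S"
      "tp W a = tp W b" for S a b
  proof (rule ccontr)
    assume neq: "tp S a \<noteq> tp S b"
    have "card S \<le> card (S \<inter> W)" using separators_meetD[OF hits S ab neq] S(2) by simp
    then have "S \<inter> W = S" using finite_subset[OF S(1) fin] by (metis card_seteq inf_le1)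
    then have "S \<subseteq> W" by blast
    from ty_mono[OF this ab(3)] show False using neq by simp
  qed
  have "V - W \<subseteq> small W"
  proof
    fix v assume v: "v \<in> V - W"
    have "\<not> k < card (cls W v)"
    proof
      assume big: "k < card (cls W v)"
      have "tp S a = tp S b"
        if "S \<subseteq> V" "card S < k" "a \<in> cls W v - S" "b \<in> cls W v - S" for S a b
        using that by - (rule ind, auto simp: cls_def)
      from no_indiscernible_set[OF _ big this] show False by (simp add: cls_def)
    qed
    then show "v \<in> small W" using v by (simp add: small_def)
  qed
  moreover have "W \<subseteq> V" using lay by (simp add: layered_def)
  ultimately have "W \<union> small W = V" by (auto simp: small_def)
  then show ?thesis using layered_absorb[OF lay] k_pos by simp
qed


section \<open>Layered sets determine the structure\<close>

text \<open>Whichever element has the lower level is determined by its type over the elements below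
  it, and at most \<open>k - 1\<close> of these suffice as parameters.\<close>

lemma layered_separator:
  assumes lay: "layered V X lev i" and uw: "u \<in> V" "w \<in> V" "u \<noteq> w" "0 < lev u" "0 < lev w"
  shows "\<exists>S\<subseteq>{v \<in> V. lev v < min (lev u) (lev w)}. finite S \<and> card S \<le> k - 1 \<and> tp S u \<noteq> tp S w"
proof -
  let ?W = "{v \<in> V. lev v < min (lev u) (lev w)}"
  have notX: "u \<notin> X" "w \<notin> X" using lay uw by (auto simp: layered_def)
  have "tp ?W u \<noteq> tp ?W w"
  proof (cases "lev u \<le> lev w")
    case True
    then show ?thesis using layered_sep[OF lay _ uw(2)] uw notX by (simp add: min_def)
  next
    case False
    then show ?thesis using layered_sep[OF lay _ uw(1), of w] uw notX by (simp add: min_def)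
  qed
  from ty_neq_small[OF this arity] show ?thesis by simp
qed

text \<open>Spoiler plays a separating set of at most \<open>k - 1\<close> elements, all of level at
  most \<open>i\<close>. By induction each is answered by itself, so \<open>u\<close> and
  \<open>w\<close> would have the same type over this set.\<close>

lemma layered_rigid:
  assumes lay: "layered V X lev n"
  shows "u \<in> V \<Longrightarrow> w \<in> V \<Longrightarrow> lev u \<le> Suc i \<or> lev w \<le> Suc i \<Longrightarrow>
    sim L M M (i * (k - 1)) (insert (u, w) (Id_on X)) \<Longrightarrow> u = w"
proof (induction i arbitrary: u w rule: less_induct)
  case (less i)
  have ne: "V \<noteq> {}" using less.prems by blast
  have X: "lev v = 0 \<longleftrightarrow> v \<in> X" if "v \<in> V" for v using lay that by (auto simp: layered_def)
  have in_X: "a = b" if ab: "a \<in> X \<or> b \<in> X" and s: "sim L M M j (insert (a, b) (Id_on X))" for a b j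
  proof -
    have s0: "sim L M M 0 (insert (a, b) (Id_on X))" using sim_le[OF ne s] by blast
    show ?thesis using sim_0_eq[OF s0, of a b a a] sim_0_eq[OF s0, of a b b b] ab by auto
  qed
  show ?case
  proof (rule ccontr)
    assume neq: "u \<noteq> w"
    then have "0 < lev u" "0 < lev w" using X in_X less.prems by blast+
    then obtain S where S: "S \<subseteq> {v \<in> V. lev v < min (lev u) (lev w)}" "finite S" "card S \<le> k - 1"
      "tp S u \<noteq> tp S w" using layered_separator[OF lay less.prems(1,2) neq] by blast
    have lev: "lev s \<le> i" if "s \<in> S" for s using S(1) that less.prems(3) by fastforce
    have SV: "S \<subseteq> V" using S(1) by blast
    \<comment> \<open>The subtraction is truncated: for \<open>i = 0\<close> the separating set lies
      in \<open>X\<close> and no round is played.\<close>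
    have "\<exists>h. h ` S \<subseteq> V \<and> sim L M M ((i - 1) * (k - 1)) ((\<lambda>s. (s, h s)) ` S \<union> insert (u, w) (Id_on X)) \<and>
      (\<forall>s\<in>S. h s = s)"
    proof (cases i)
      case 0
      then have "S \<subseteq> X" using lev X SV by auto
      then have "sim L M M (i * (k - 1)) ((\<lambda>s. (s, s)) ` S \<union> insert (u, w) (Id_on X))"
        by (intro sim_mono[OF less.prems(4)]) auto
      then show ?thesis using SV 0 by (intro exI[of _ "\<lambda>s. s"]) auto
    next
      case (Suc i')
      obtain h where h: "h ` S \<subseteq> V" "sim L M M (i' * (k - 1)) ((\<lambda>s. (s, h s)) ` S \<union> insert (u, w) (Id_on X))"
        using sim_moves_fun[OF less.prems(4) S(2) SV _ ne, of "i' * (k - 1)"] S(3) Suc by auto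
      have "h s = s" if "s \<in> S" for s
      proof -
        have "sim L M M (i' * (k - 1)) (insert (s, h s) (Id_on X))"
          by (rule sim_mono[OF h(2)]) (use that in auto)
        moreover have "s \<in> V" "h s \<in> V" "lev s \<le> Suc i'" using that lev[of s] SV h(1) Suc by auto
        ultimately show ?thesis using less.IH[of i' s "h s"] Suc by simp
      qed
      moreover have "i - 1 = i'" using Suc by simp
      ultimately show ?thesis using h by (intro exI[of _ h] conjI) simp_all
    qed
    then obtain h where h: "sim L M M ((i - 1) * (k - 1)) ((\<lambda>s. (s, h s)) ` S \<union> insert (u, w) (Id_on X))"
      "\<And>s. s \<in> S \<Longrightarrow> h s = s" by blast
    have "sim L M M 0 ((\<lambda>s. (s, s)) ` S \<union> {(u, w)})"
      by (rule sim_mono[OF sim_le[OF ne h(1) le0]]) (use h(2) in force)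
    from sim_0_ty[OF this, of u w S "\<lambda>s. s"] have "tp S w = tp S u"
      by (auto simp: ty_def id_def)
    then show False using S(4) by simp
  qed
qed

text \<open>The isomorphism \<open>\<theta>\<close> sends \<open>u\<close> to an answer of
  Duplicator when Spoiler opens with \<open>u\<close> in \<open>M\<close>. In the game from
  \<open>N\<close>, \<open>max k 2\<close> rounds play the elements to be compared, and the other
  \<open>(k - 1) * (k - 1)\<close> pin down their answers.\<close>

lemma isomorphic_if_sim:
  fixes N :: "'b struct"
  assumes lay: "layered V X lev k" and ne: "V \<noteq> {}"
    and P: "P \<subseteq> X \<times> univ N" "X \<subseteq> fst ` P"
    and K: "K = (k - 1) * (k - 1) + max k 2"
    and MN: "sim L M N K P" and NM: "sim L N M K (P\<inverse>)"
  shows "isomorphic L M N"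
proof -
  have X: "lev v = 0 \<longleftrightarrow> v \<in> X" and lev_le: "lev v \<le> k" if "v \<in> V" for v
    using lay that by (auto simp: layered_def)
  let ?J = "(k - 1) * (k - 1)"
  have J_le: "?J \<le> K - 1" using K by simp
  have "\<exists>z\<in>univ N. sim L M N (K - 1) (insert (u, z) P)" if "u \<in> V" for u
  proof -
    have "K = Suc (K - 1)" using K by (simp add: max_def)
    then show ?thesis using MN that sim.simps(2) by metis
  qed
  then obtain \<theta> where \<theta>: "\<And>u. u \<in> V \<Longrightarrow> \<theta> u \<in> univ N"
    "\<And>u. u \<in> V \<Longrightarrow> sim L M N (K - 1) (insert (u, \<theta> u) P)" by metis
  have neN: "univ N \<noteq> {}" using \<theta>(1) ne by blast
  \<comment> \<open>Composing the two games gives a game inside \<open>M\<close> that fixes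
    \<open>X\<close>, where rigidity applies. Thus \<open>\<theta> u\<close> can only be answered by
    \<open>u\<close>.\<close>
  have pull: "u = w" if u: "u \<in> V" "w \<in> V" "lev u \<le> Suc i" and i: "i \<le> k - 1" and
    s: "sim L M N (K - 1) (insert (u, z) P)" "sim L N M (i * (k - 1)) Q" "insert (z, w) (P\<inverse>) \<subseteq> Q" for u w i z Q
  proof -
    have "i * (k - 1) \<le> K - 1" using i J_le by (meson le_trans mult_le_mono1)
    then have "sim L M N (i * (k - 1)) (insert (u, z) P)" using sim_le[OF ne s(1)] by blast
    from sim_trans[OF this s(2)] have "sim L M M (i * (k - 1)) (insert (u, w) (Id_on X))"
      by (rule sim_mono) (use s(3) P in force)
    then show ?thesis using layered_rigid[OF lay u(1,2), of i] u(3) by blast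
  qed
  \<comment> \<open>Spoiler plays the \<open>\<theta>\<close>-images of a set separating
    \<open>u\<close> from \<open>w\<close>. By \<open>pull\<close> they are answered by their
    preimages, so both types over this set are read off from \<open>z\<close> in
    \<open>N\<close>.\<close>
  have uniq: "u = w" if uw: "u \<in> V" "w \<in> V"
    and s: "sim L N M ?J (insert (z, u) (P\<inverse>))" "sim L N M ?J (insert (z, w) (P\<inverse>))" for z u w
  proof (rule ccontr)
    assume neq: "u \<noteq> w"
    have not_X: "a \<notin> X" if ab: "a \<noteq> b" "sim L N M ?J (insert (z, a) (P\<inverse>))" "sim L N M ?J (insert (z, b) (P\<inverse>))" for a b
    proof
      assume "a \<in> X"
      then obtain y where y: "(y, a) \<in> P\<inverse>" using P(2) by force
      have s0: "sim L N M 0 (insert (z, a) (P\<inverse>))" "sim L N M 0 (insert (z, b) (P\<inverse>))"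
        using sim_le[OF neN] ab by blast+
      have "z = y" using sim_0_eq[OF s0(1), of z a y a] y by blast
      then show False using sim_0_eq[OF s0(2), of z b y a] y ab(1) by blast
    qed
    have "u \<notin> X" "w \<notin> X" using not_X[OF neq s] not_X[OF neq[symmetric] s(2,1)] by simp_all
    then have "0 < lev u" "0 < lev w" using X uw by auto
    then obtain S where S: "S \<subseteq> {v \<in> V. lev v < min (lev u) (lev w)}" "finite S" "card S \<le> k - 1"
      "tp S u \<noteq> tp S w" using layered_separator[OF lay uw neq] by blast
    \<comment> \<open>The parameters are at least one level below the top, which saves the
      \<open>k - 1\<close> rounds needed to play their images.\<close>
    have lev: "lev s \<le> Suc (k - 2)" if "s \<in> S" for s
      using S(1) that lev_le[OF uw(1)] by fastforce
    have SV: "S \<subseteq> V" using S(1) by blast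
    have budget: "card (\<theta> ` S) + (k - 2) * (k - 1) \<le> ?J"
    proof -
      have "card (\<theta> ` S) \<le> k - 1" using card_image_le[OF S(2), of \<theta>] S(3) by simp
      moreover have "(k - 1) + (k - 2) * (k - 1) \<le> ?J" by (cases "k - 1") (auto simp: numeral_2_eq_2 diff_Suc split: nat.splits)
      ultimately show ?thesis by simp
    qed
    have "tp S v = {(R, t). R < length L \<and> length t = L ! R \<and> set t \<subseteq> insert None (Some ` S) \<and>
        rel N R (map (case_option z \<theta>) t)}" if sv: "sim L N M ?J (insert (z, v) (P\<inverse>))" for v
    proof -
      have "finite (\<theta> ` S)" "\<theta> ` S \<subseteq> univ N" using S(2) SV \<theta>(1) by auto
      from sim_moves_fun[OF sv this budget neN] obtain h where h: "h ` \<theta> ` S \<subseteq> V"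
        "sim L N M ((k - 2) * (k - 1)) ((\<lambda>s. (s, h s)) ` \<theta> ` S \<union> insert (z, v) (P\<inverse>))" by blast
      have "h (\<theta> s) = s" if "s \<in> S" for s
        using that h(1) SV lev by (intro pull[symmetric, OF _ _ _ _ \<theta>(2) h(2)]) auto
      then have "(\<theta> s, s) \<in> (\<lambda>s. (s, h s)) ` \<theta> ` S \<union> insert (z, v) (P\<inverse>)" if "s \<in> S" for s
        using that by (auto simp: image_iff intro!: bexI[of _ s])
      then show ?thesis by (intro sim_0_ty[OF sim_le[OF neN h(2) le0]]) auto
    qed
    from this[OF s(1)] this[OF s(2)] show False using S(4) by simp
  qed
  have h_theta: "sim L N M ?J ((\<lambda>s. (s, h s)) ` T \<union> P\<inverse>) \<Longrightarrow> u \<in> V \<Longrightarrow> \<theta> u \<in> T \<Longrightarrow> h ` T \<subseteq> V \<Longrightarrow> h (\<theta> u) = u" for h T u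
    using lev_le k_pos by (intro pull[symmetric, of u "h (\<theta> u)" "k - 1" "\<theta> u", OF _ _ _ _ \<theta>(2)]) auto
  have moves: "\<exists>h. h ` T \<subseteq> V \<and> sim L N M ?J ((\<lambda>s. (s, h s)) ` T \<union> P\<inverse>)"
    if "finite T" "T \<subseteq> univ N" "card T \<le> max k 2" for T
    using that K by (intro sim_moves_fun[OF NM _ _ _ neN]) auto
  have "inj_on \<theta> V"
  proof (rule inj_onI)
    fix u w assume uw: "u \<in> V" "w \<in> V" "\<theta> u = \<theta> w"
    obtain h where h: "h ` {\<theta> u} \<subseteq> V" "sim L N M ?J ((\<lambda>s. (s, h s)) ` {\<theta> u} \<union> P\<inverse>)"
      using moves[of "{\<theta> u}"] \<theta>(1) uw by (auto simp: le_max_iff_disj)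
    have "h (\<theta> u) = u" by (rule h_theta[OF h(2) uw(1) _ h(1)]) simp
    moreover have "h (\<theta> w) = w" by (rule h_theta[OF h(2) uw(2) _ h(1)]) (simp add: uw(3))
    ultimately show "u = w" using uw(3) by metis
  qed
  moreover have "univ N \<subseteq> \<theta> ` V"
  proof
    fix z assume z: "z \<in> univ N"
    obtain h0 where h0: "h0 ` {z} \<subseteq> V" "sim L N M ?J ((\<lambda>s. (s, h0 s)) ` {z} \<union> P\<inverse>)"
      using moves[of "{z}"] z by (auto simp: le_max_iff_disj)
    define u where "u = h0 z"
    have u: "u \<in> V" "sim L N M ?J (insert (z, u) (P\<inverse>))" using h0 by (auto simp: u_def)
    \<comment> \<open>Both elements are played together: \<open>\<theta> u\<close> is answered by
      \<open>u\<close> and, by \<open>uniq\<close>, so is \<open>z\<close>, hence they are equal.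
      This is why \<open>K\<close> contains \<open>max k 2\<close> instead of
      \<open>k\<close>.\<close>
    have "card {z, \<theta> u} \<le> 2" by (simp add: card_insert_if)
    then obtain h where h: "h ` {z, \<theta> u} \<subseteq> V" "sim L N M ?J ((\<lambda>s. (s, h s)) ` {z, \<theta> u} \<union> P\<inverse>)"
      using moves[of "{z, \<theta> u}"] z \<theta>(1)[OF u(1)] by (auto simp: le_max_iff_disj)
    have "h (\<theta> u) = u" using h_theta[OF h(2) u(1) _ h(1)] by simp
    moreover have "sim L N M ?J (insert (z, h z) (P\<inverse>))" by (rule sim_mono[OF h(2)]) auto
    then have "h z = u" using uniq[OF _ u(1) _ u(2)] h(1) by auto
    ultimately have "z = \<theta> u"
      using sim_0_eq[OF sim_le[OF neN h(2) le0], of z "h z" "\<theta> u" "h (\<theta> u)"] by auto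
    then show "z \<in> \<theta> ` V" using u(1) by blast
  qed
  moreover have "rel M R t \<longleftrightarrow> rel N R (map \<theta> t)" if R: "R < length L" and t: "t \<in> tuples M (L ! R)" for R t
  proof -
    have tV: "set t \<subseteq> V" "length t = L ! R" using t by (auto simp: tuples_def)
    \<comment> \<open>The images of the entries take at most \<open>k\<close> rounds and are
      answered by the entries, so the final position compares both tuples.\<close>
    have "card (\<theta> ` set t) \<le> k"
      using card_image_le[of "set t" \<theta>] card_length[of t] tV(2) arity[OF R] by fastforce
    moreover have "\<theta> ` set t \<subseteq> univ N" using \<theta>(1) tV(1) by auto
    ultimately obtain h where h: "h ` \<theta> ` set t \<subseteq> V" "sim L N M ?J ((\<lambda>s. (s, h s)) ` \<theta> ` set t \<union> P\<inverse>)"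
      using moves[of "\<theta> ` set t"] by (auto simp: le_max_iff_disj)
    have hid: "h (\<theta> u) = u" if "u \<in> set t" for u using h_theta[OF h(2) _ _ h(1)] that tV(1) by auto
    let ?ps = "map (\<lambda>u. (\<theta> u, u)) t"
    have "set ?ps \<subseteq> (\<lambda>s. (s, h s)) ` \<theta> ` set t \<union> P\<inverse>" using hid by force
    from sim_0_rel[OF sim_le[OF neN h(2) le0] R _ this] tV(2) show ?thesis by (simp add: comp_def)
  qed
  ultimately have "iso L \<theta> M N" using \<theta>(1) by (auto simp: iso_def bij_betw_def)
  then show ?thesis by (auto simp: isomorphic_def)
qed

text \<open>No class is left outside \<open>V\<close>, so the account of the layering becomes the
  bound on \<open>p\<close>, where \<open>p\<close> and \<open>u\<close> are the sizes of
  \<open>X\<close> and of its complement.\<close>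

lemma D1_bound:
  assumes M: "is_struct L M" and ne: "V \<noteq> {}"
  shows "\<exists>p u. card V = p + u \<and> p + (k - 1) \<le> 2 * (k - 1) * u \<and> 0 < u \<and>
    D1 L M \<le> p + ((k - 1) * (k - 1) + max k 2)"
proof -
  let ?K = "(k - 1) * (k - 1) + max k 2"
  obtain X lev where lay: "layered V X lev k" using exists_layering[OF ne] by blast
  then have XV: "X \<subseteq> V" and bound: "card X + (k - 1) \<le> (k - 1) * (2 * card (V - X) + num_classes V)"
    by (auto simp: layered_def)
  have finX: "finite X" using XV fin finite_subset by blast
  have card: "card V = card X + card (V - X)"
    using XV fin finX by (metis card_Diff_subset card_mono le_add_diff_inverse)
  have "num_classes V = 0" by (simp add: num_classes_def)
  with bound have bound: "card X + (k - 1) \<le> 2 * (k - 1) * card (V - X)" by (simp add: algebra_simps)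
  have "0 < card (V - X)"
  proof (rule ccontr)
    assume "\<not> 0 < card (V - X)"
    then have "card X = 0" "card V = card X" using bound card by simp_all
    then show False using fin ne by simp
  qed
  moreover obtain a where "bij_betw a {0..<card X} X" using ex_bij_betw_nat_finite[OF finX] by blast
  then have a: "a ` {..<card X} = X" by (simp add: bij_betw_def atLeast0LessThan)
  have "D1 L M \<le> card X + ?K"
  proof (rule D1_le[OF M ne])
    show "0 < ?K" by (simp add: max_def)
    show "a i \<in> V" if "i < card X" for i using a XV that by blast
    fix N :: "nat struct" and b
    assume "\<And>i. i < card X \<Longrightarrow> b i \<in> univ N" "sim L M N ?K ((\<lambda>i. (a i, b i)) ` {..<card X})"
      "sim L N M ?K ((\<lambda>i. (b i, a i)) ` {..<card X})"
    then show "isomorphic L M N"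
      using a by (intro isomorphic_if_sim[OF lay ne _ _ refl, of "(\<lambda>i. (a i, b i)) ` {..<card X}"])
        (auto simp: converse_pairs image_image)
  qed
  ultimately show ?thesis using card bound by blast
qed

end

section \<open>The empty structure and the final estimate\<close>

lemma D1_empty:
  assumes "vocabulary L" "univ M = {}"
  shows "D1 L M \<le> 1"
proof -
  let ?\<phi> = "All 0 (Neg (Eq 0 0))"
  have "isomorphic L M N" if "univ N = {}" for N :: "nat struct"
  proof -
    \<comment> \<open>As arities are positive, there are no tuples on which two empty structures
      could differ.\<close>
    have "tuples M (L ! R) = {}" if "R < length L" for R
      using assms nth_mem[OF that] by (auto simp: tuples_def vocabulary_def)
    then show ?thesis using assms(2) that by (simp add: isomorphic_def iso_def bij_betw_def)
  qed
  then have "defines_struct L ?\<phi> M"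
    using assms(2) by (auto simp: defines_struct_def closed_fm_def true_on_def)
  moreover have "alternation_number ?\<phi> \<le> 1" "quantifier_rank ?\<phi> = 1"
    by (simp_all add: alternation_number_def alternations_def quantifier_rank_def)
  ultimately show ?thesis unfolding D1_def by (intro Least_le) blast
qed

theorem theorem4p3:
  fixes L :: vocab and M :: "'a struct" and n k :: nat
  assumes "vocabulary L" and "L \<noteq> []"
    and "is_struct L M" and "irredundant L M"
    and "card (univ M) = n" and "max_arity L = k"
    and "2 \<le> k \<or> 3 \<le> n"
  shows "real (D1 L M) < (1 - 1 / (2 * real k)) * real n + (real k)\<^sup>2 - real k + 1"
proof -
  have fin: "finite (univ M)" using assms(3) by (simp add: is_struct_def)
  have arity: "L ! R \<le> k" if "R < length L" for R
    using that assms(6) by (auto simp: max_arity_def)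
  have "k \<in> set L" using assms(2,6) Max_in[of "set L"] by (simp add: max_arity_def)
  then have k_pos: "0 < k" using assms(1) by (auto simp: vocabulary_def)
  interpret irredundant_struct L M k
    by unfold_locales (use fin assms(4) arity k_pos in auto)
  show ?thesis
  proof (cases "univ M = {}")
    case True
    then have "n = 0" "2 \<le> k" using assms(5,7) by auto
    have "real (D1 L M) \<le> 1" using D1_empty[OF assms(1) True] by simp
    moreover have "real k * 2 \<le> real k * real k" using \<open>2 \<le> k\<close> by (intro mult_left_mono) auto
    moreover have "2 \<le> real k" using \<open>2 \<le> k\<close> by simp
    ultimately have "real (D1 L M) < real k * real k - real k + 1" by linarith
    then show ?thesis using \<open>n = 0\<close> by (simp add: power2_eq_square)
  next
    case False
    then obtain p u where pu: "n = p + u" "p + (k - 1) \<le> 2 * (k - 1) * u" "0 < u"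
      and D1: "D1 L M \<le> p + ((k - 1) * (k - 1) + max k 2)"
      using D1_bound assms(3,5) by blast
    show ?thesis
    proof (cases "2 \<le> k")
      case False
      \<comment> \<open>Here \<open>p = 0\<close> and two rounds remain;
        \<open>2 < n / 2 + 1\<close> amounts to \<open>3 \<le> n\<close>.\<close>
      then have "k = 1" using k_pos by simp
      then show ?thesis using pu D1 assms(7) by simp
    next
      case True
      \<comment> \<open>With \<open>n = p + u\<close> this is equivalent to
        \<open>p < (1 - 1 / (2 * k)) * n\<close>. The summand \<open>k - 1\<close> makes it
        strict.\<close>
      have "p < (2 * k - 1) * u"
      proof -
        have "p < 2 * (k - 1) * u" using pu(2) True by linarith
        also have "\<dots> \<le> (2 * k - 1) * u" by (intro mult_le_mono1) simp
        finally show ?thesis .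
      qed
      then have "real p < real ((2 * k - 1) * u)" by (simp only: of_nat_less_iff)
      also have "\<dots> = (2 * real k - 1) * real u" using True by (simp add: of_nat_diff)
      finally have "real p / (2 * real k) + real u / (2 * real k) < real u"
        using k_pos by (simp add: field_simps)
      then have "real p < (1 - 1 / (2 * real k)) * real n"
        by (simp add: pu(1) algebra_simps add_divide_distrib)
      moreover have "real (D1 L M) \<le> real p + ((real k - 1) * (real k - 1) + real k)"
      proof -
        have "real (D1 L M) \<le> real (p + ((k - 1) * (k - 1) + max k 2))" using D1 by (simp only: of_nat_le_iff)
        then show ?thesis using True by (simp add: of_nat_diff max_def)
      qed
      ultimately show ?thesis by (simp add: power2_eq_square algebra_simps)
    qed
  qed
qed

end
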